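(* Let $\mathbf{X}\in\mathbb{R}^{n\times p}$, $\mathbf{y}\in\mathbb{R}^n$, and let $S\subset\{1,\dots,p\}$ be nonempty with $\mathbf{X}_S$ of full column rank. Let $\mathbf{C}=(\mathbf{X}_S^T\mathbf{X}_S)^{-1}$, and for $j\in S$, if $j$ is the $i$-th element of $S$, let $\mathbf{e}_j\in\mathbb{R}^{|S|}$ be the $i$-th standard basis vector. Let $$j^*\in\operatorname*{argmax}_{j\in S}\ \mathbf{y}^T\mathbf{X}_S(\mathbf{I}-\mathbf{e}_j\mathbf{e}_j^T)\left(\mathbf{C}-\frac{\mathbf{C}\mathbf{e}_j\mathbf{e}_j^T\mathbf{C}}{\mathbf{e}_j^T\mathbf{C}\mathbf{e}_j}\right)(\mathbf{I}-\mathbf{e}_j\mathbf{e}_j^T)\mathbf{X}_S^T\mathbf{y}.$$ Then $$f(S\setminus\{j^*\})\le f(S\setminus\{j\})\qquad\text{for all } j\in S .$$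
   Context: For an index set $T\subset\{1,\dots,p\}$, $\mathbf{X}_T$ is the submatrix of $\mathbf{X}$ with columns indexed by $T$ (in the fixed order of the elements of $T$), and $$f(T)=\inf\{\|\mathbf{y}-\mathbf{X}\boldsymbol{\beta}\|_2^2:\ \boldsymbol{\beta}\in\mathbb{R}^p,\ \operatorname{supp}(\boldsymbol{\beta})=T\},$$ where $\operatorname{supp}(\boldsymbol{\beta})$ is the set of indices of nonzero entries of $\boldsymbol{\beta}$. *)

theory Defs
  imports Complex_Main "Jordan_Normal_Form.DL_Rank_Submatrix"
begin

text \<open>
  Vectors and matrices are the dimension-carrying ones of \<open>Jordan_Normal_Form\<close>, whose indices
  start at 0. Accordingly index sets are subsets of \<open>{..<p}\<close> instead of \<open>{1..p}\<close>, and the elements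
  of an index set \<open>S\<close>, in increasing order, are \<open>pick S 0, ..., pick S (card S - 1)\<close>.
\<close>

definition supp_vec :: "real vec \<Rightarrow> nat set" where
  "supp_vec b = {i. i < dim_vec b \<and> b $ i \<noteq> 0}"

definition l2_norm_vec :: "real vec \<Rightarrow> real" where
  "l2_norm_vec v = sqrt (\<Sum>i<dim_vec v. (v $ i)\<^sup>2)"

text \<open>
  The infimum is the conditionally complete one on the reals. For \<open>T \<subseteq> {..<dim_col X}\<close> the set is
  nonempty and bounded below by 0. Note that the support has to be equal to \<open>T\<close>, so that the
  infimum need not be attained.
\<close>

definition restricted_loss :: "real mat \<Rightarrow> real vec \<Rightarrow> nat set \<Rightarrow> real" where
  "restricted_loss X y T =
    Inf {(l2_norm_vec (y - X *\<^sub>v b))\<^sup>2 | b. b \<in> carrier_vec (dim_col X) \<and> supp_vec b = T}"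

definition col_submatrix :: "real mat \<Rightarrow> nat set \<Rightarrow> real mat" where
  "col_submatrix X S = submatrix X UNIV S"

text \<open>
  \<open>mat_inverse\<close> yields an option; it is \<open>Some\<close> of the inverse whenever the Gram matrix is
  invertible, in particular if \<open>col_submatrix X S\<close> has full column rank.
\<close>

definition inv_gram :: "real mat \<Rightarrow> nat set \<Rightarrow> real mat" where
  "inv_gram X S =
    the (mat_inverse (transpose_mat (col_submatrix X S) * col_submatrix X S))"

text \<open>
  The number of elements of \<open>S\<close> below \<open>j\<close> is the position (from 0) of \<open>j\<close> in \<open>S\<close>.
\<close>

definition basis_vec :: "nat set \<Rightarrow> nat \<Rightarrow> real vec" where
  "basis_vec S j = unit_vec (card S) (card {a \<in> S. a < j})"

lemma pick_position:
  assumes "j \<in> S"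
  shows "pick S (card {a \<in> S. a < j}) = j"
  using assms by (rule pick_card_in_set)

definition outer_prod_vec :: "real vec \<Rightarrow> real vec \<Rightarrow> real mat" where
  "outer_prod_vec u v = mat (dim_vec u) (dim_vec v) (\<lambda>(i, j). u $ i * v $ j)"

definition removal_score :: "real mat \<Rightarrow> real vec \<Rightarrow> nat set \<Rightarrow> nat \<Rightarrow> real" where
  "removal_score X y S j =
    (let XS = col_submatrix X S;
         C = inv_gram X S;
         e = basis_vec S j;
         E = outer_prod_vec e e;
         Q = 1\<^sub>m (card S) - E
     in y \<bullet> ((XS * Q * (C - (1 / (e \<bullet> (C *\<^sub>v e))) \<cdot>\<^sub>m (C * E * C)) * Q * transpose_mat XS) *\<^sub>v y))"

end

theory Submission
  imports Defs
begin

text \<open>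
  Removing \<open>j\<close> from \<open>S\<close> costs exactly \<open>y \<bullet> y\<close> minus the score of \<open>j\<close>
  (\<open>restricted_loss_remove_eq\<close>), so the largest score leaves the smallest loss.

  For this identity put \<open>A = X\<^sub>S\<close>, \<open>G = A\<^sup>T A\<close>, \<open>C = G\<inverse>\<close> and \<open>z = A\<^sup>T y\<close>, and let \<open>k\<close> be
  the position of \<open>j\<close> in \<open>S\<close> and \<open>e\<close> the \<open>k\<close>-th unit vector. The matrix
  \<open>D = C - C e e\<^sup>T C / (e\<^sup>T C e)\<close> is, up to a zero row and column, the inverse of the Gram matrix
  of the remaining columns: \<open>D e = 0\<close>, \<open>e\<^sup>T D = 0\<close>, and \<open>G D\<close> differs from the identity only by
  a matrix with values in the span of \<open>e\<close>. Hence \<open>w = D z\<close> has \<open>k\<close>-th entry 0, and its residual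
  \<open>y - A w\<close> is orthogonal to \<open>A v\<close> whenever \<open>v\<close> has \<open>k\<close>-th entry 0
  (\<open>residual_orthogonal\<close>). By Pythagoras \<open>w\<close> minimises the squared residual among all such
  vectors, with minimum \<open>y \<bullet> y - z \<bullet> D z\<close> (\<open>zeroed_solution_loss\<close>). Since \<open>D\<close> kills
  \<open>e\<close> on both sides, the factors \<open>I - e e\<^sup>T\<close> in the score change nothing, and the score is
  \<open>z \<bullet> D z\<close> (\<open>score_matrix_apply\<close>).

  It remains to pass from \<open>S - {j}\<close> as a bound on the support to \<open>S - {j}\<close> as the support itself.
  The vectors whose support is the whole set are dense among those supported in it and the loss is
  continuous, so the infimum is the same (\<open>restricted_loss_le_of_supp_subset\<close>), although it may
  no longer be attained.
\<close>

section \<open>Scalar products and the squared norm\<close>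

lemma l2_norm_vec_square: "(l2_norm_vec v)\<^sup>2 = v \<bullet> v"
  unfolding l2_norm_vec_def scalar_prod_def
  by (subst real_sqrt_pow2) (auto simp: sum_nonneg power2_eq_square atLeast0LessThan)

lemma scalar_prod_self_nonneg: "0 \<le> v \<bullet> (v :: real vec)"
  by (simp add: l2_norm_vec_square [symmetric])

lemma scalar_prod_self_eq_0:
  assumes "v \<in> carrier_vec n" and "v \<bullet> (v :: real vec) = 0"
  shows "v = 0\<^sub>v n"
proof -
  have "\<forall>i\<in>{0..<n}. v $ i * v $ i = 0"
    using assms unfolding scalar_prod_def
    by (subst sum_nonneg_eq_0_iff [symmetric]) auto
  with assms(1) show ?thesis by (intro eq_vecI) auto
qed

lemma scalar_prod_self_add:
  assumes "u \<in> carrier_vec n" and "v \<in> carrier_vec n"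
  shows "(u + v) \<bullet> (u + v) = u \<bullet> u + 2 * (u \<bullet> v) + v \<bullet> (v :: real vec)"
proof -
  have "(u + v) \<bullet> (u + v) = u \<bullet> u + v \<bullet> u + (u \<bullet> v + v \<bullet> v)"
    using assms by (simp add: scalar_prod_add_distrib[of _ n] add_scalar_prod_distrib[of _ n])
  with assms show ?thesis by (simp add: comm_scalar_prod[of v n u])
qed

lemma smult_mat_mult_vec:
  assumes "A \<in> carrier_mat n m" and "v \<in> carrier_vec m"
  shows "(k \<cdot>\<^sub>m A) *\<^sub>v v = (k :: real) \<cdot>\<^sub>v (A *\<^sub>v v)"
  using assms by (intro eq_vecI) auto

lemma outer_prod_vec_carrier:
  "u \<in> carrier_vec n \<Longrightarrow> v \<in> carrier_vec m \<Longrightarrow> outer_prod_vec u v \<in> carrier_mat n m"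
  by (auto simp: outer_prod_vec_def)

lemma outer_prod_vec_mult_vec:
  assumes "v \<in> carrier_vec m" and "x \<in> carrier_vec m"
  shows "outer_prod_vec u v *\<^sub>v x = (v \<bullet> x) \<cdot>\<^sub>v u"
proof (rule eq_vecI)
  fix i assume "i < dim_vec ((v \<bullet> x) \<cdot>\<^sub>v u)"
  then have "row (outer_prod_vec u v) i = u $ i \<cdot>\<^sub>v v"
    and "i < dim_row (outer_prod_vec u v)"
    by (auto simp: outer_prod_vec_def)
  with assms show "(outer_prod_vec u v *\<^sub>v x) $ i = ((v \<bullet> x) \<cdot>\<^sub>v u) $ i"
    using \<open>i < dim_vec ((v \<bullet> x) \<cdot>\<^sub>v u)\<close> by simp
qed (simp add: outer_prod_vec_def)

section \<open>Least squares with one coefficient forced to be zero\<close>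

text \<open>
  This is \<open>D z\<close> for \<open>D = C - C e e\<^sup>T C / (e\<^sup>T C e)\<close>, where \<open>e\<close> is the \<open>k\<close>-th unit vector: the
  multiple of \<open>C e\<close> subtracted from \<open>C z\<close> is the one that makes the \<open>k\<close>-th entry vanish.
\<close>

definition zeroed_solution :: "real mat \<Rightarrow> nat \<Rightarrow> real vec \<Rightarrow> real vec" where
  "zeroed_solution C k z =
    C *\<^sub>v z - ((C *\<^sub>v z) $ k / (C *\<^sub>v unit_vec (dim_row C) k) $ k) \<cdot>\<^sub>v
      (C *\<^sub>v unit_vec (dim_row C) k)"

lemma zeroed_solution_carrier:
  "C \<in> carrier_mat m m \<Longrightarrow> zeroed_solution C k z \<in> carrier_vec m"
  unfolding zeroed_solution_def
  by (intro carrier_vecI) simp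

lemma zeroed_solution_index_eq_0:
  assumes "C \<in> carrier_mat m m" and "k < m"
    and "(C *\<^sub>v unit_vec m k) $ k \<noteq> 0"
  shows "zeroed_solution C k z $ k = 0"
  using assms by (simp add: zeroed_solution_def)

text \<open>
  The normal equations of the constrained problem. The Gram matrix sends \<open>zeroed_solution C k z\<close>
  to \<open>z\<close> minus a multiple of the \<open>k\<close>-th unit vector, and the error is invisible to every \<open>w\<close>
  whose \<open>k\<close>-th entry is 0.
\<close>

lemma residual_orthogonal:
  fixes A :: "real mat"
  assumes A: "A \<in> carrier_mat n m" and y: "y \<in> carrier_vec n"
    and C: "C \<in> carrier_mat m m" and inv: "(transpose_mat A * A) * C = 1\<^sub>m m"
    and k: "k < m" and w: "w \<in> carrier_vec m" "w $ k = 0"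
  shows "(A *\<^sub>v w) \<bullet> (A *\<^sub>v zeroed_solution C k (transpose_mat A *\<^sub>v y)) = (A *\<^sub>v w) \<bullet> y"
proof -
  let ?z = "transpose_mat A *\<^sub>v y" and ?e = "unit_vec m k :: real vec"
  let ?a = "(C *\<^sub>v ?z) $ k / (C *\<^sub>v ?e) $ k"
  note cs = A y C w
  have z: "?z \<in> carrier_vec m" using A y by simp
  have gram: "(A *\<^sub>v w) \<bullet> (A *\<^sub>v (C *\<^sub>v x)) = w \<bullet> x" if x: "x \<in> carrier_vec m" for x
  proof -
    have At: "transpose_mat A \<in> carrier_mat m n" using A by simp
    have "(A *\<^sub>v w) \<bullet> (A *\<^sub>v (C *\<^sub>v x)) = (transpose_mat A *\<^sub>v (A *\<^sub>v (C *\<^sub>v x))) \<bullet> w"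
      using cs x transpose_vec_mult_scalar[OF A w(1), of "A *\<^sub>v (C *\<^sub>v x)"]
      by (metis comm_scalar_prod mult_mat_vec_carrier)
    also have "transpose_mat A *\<^sub>v (A *\<^sub>v (C *\<^sub>v x)) = (transpose_mat A * A) *\<^sub>v (C *\<^sub>v x)"
      using C x by (intro assoc_mult_mat_vec[symmetric, OF At A]) auto
    also have "\<dots> = ((transpose_mat A * A) * C) *\<^sub>v x"
      using C x At A by (intro assoc_mult_mat_vec[symmetric, of _ m m _ m]) auto
    also have "\<dots> = x" using x inv by simp
    finally show ?thesis using x w by (simp add: comm_scalar_prod[of x m])
  qed
  have "A *\<^sub>v zeroed_solution C k ?z = A *\<^sub>v (C *\<^sub>v ?z) - ?a \<cdot>\<^sub>v (A *\<^sub>v (C *\<^sub>v ?e))"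
    using A C z by (simp add: zeroed_solution_def mult_minus_distrib_mat_vec[of A n m] mult_mat_vec)
  then have "(A *\<^sub>v w) \<bullet> (A *\<^sub>v zeroed_solution C k ?z) = w \<bullet> ?z - ?a * (w \<bullet> ?e)"
    using cs z gram[OF z] gram[of ?e]
    by (simp add: scalar_prod_minus_distrib[of _ n])
  also have "w \<bullet> ?e = 0" using w k by simp
  also have "w \<bullet> ?z = (A *\<^sub>v w) \<bullet> y"
    using transpose_vec_mult_scalar[OF A w(1) y] cs z
    by (metis comm_scalar_prod mult_mat_vec_carrier)
  finally show ?thesis by simp
qed

text \<open>
  Any competing residual is \<open>r\<close> plus a vector \<open>A v\<close> with \<open>v $ k = 0\<close>, and the two are
  orthogonal, so Pythagoras gives minimality. Orthogonality of \<open>r\<close> to \<open>A\<close> times the solution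
  itself gives the value of the minimum.
\<close>

lemma zeroed_solution_loss:
  fixes A :: "real mat"
  assumes A: "A \<in> carrier_mat n m" and y: "y \<in> carrier_vec n"
    and C: "C \<in> carrier_mat m m" and inv: "(transpose_mat A * A) * C = 1\<^sub>m m"
    and k: "k < m" and nz: "(C *\<^sub>v unit_vec m k) $ k \<noteq> 0"
  defines "z \<equiv> transpose_mat A *\<^sub>v y"
  defines "r \<equiv> y - A *\<^sub>v zeroed_solution C k z"
  shows "r \<bullet> r = y \<bullet> y - z \<bullet> zeroed_solution C k z"
    and "\<And>w. w \<in> carrier_vec m \<Longrightarrow> w $ k = 0 \<Longrightarrow> r \<bullet> r \<le> (y - A *\<^sub>v w) \<bullet> (y - A *\<^sub>v w)"
proof -
  let ?w0 = "zeroed_solution C k z"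
  have z: "z \<in> carrier_vec m" using A y by (simp add: z_def)
  have w0: "?w0 \<in> carrier_vec m" "?w0 $ k = 0"
    using zeroed_solution_carrier[OF C] zeroed_solution_index_eq_0[OF C k nz] by auto
  have r: "r \<in> carrier_vec n" using A y w0 by (simp add: r_def)
  have orth: "r \<bullet> (A *\<^sub>v w) = 0" if w: "w \<in> carrier_vec m" "w $ k = 0" for w
  proof -
    have "r \<bullet> (A *\<^sub>v w) = (A *\<^sub>v w) \<bullet> r"
      using A w r by (intro comm_scalar_prod[of _ n]) auto
    also have "\<dots> = (A *\<^sub>v w) \<bullet> y - (A *\<^sub>v w) \<bullet> (A *\<^sub>v ?w0)"
      unfolding r_def using A y w w0 by (intro scalar_prod_minus_distrib[of _ n]) auto
    finally show ?thesis using residual_orthogonal[OF A y C inv k w] by (simp add: z_def)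
  qed
  have "r \<bullet> r = r \<bullet> y - r \<bullet> (A *\<^sub>v ?w0)"
    by (subst (2) r_def, rule scalar_prod_minus_distrib[of _ n]) (use A y w0 r in auto)
  also have "\<dots> = y \<bullet> y - (A *\<^sub>v ?w0) \<bullet> y"
    using orth[OF w0] A y w0 by (simp add: r_def minus_scalar_prod_distrib[of _ n])
  also have "(A *\<^sub>v ?w0) \<bullet> y = z \<bullet> ?w0"
    using transpose_vec_mult_scalar[OF A w0(1) y] A y w0
    by (metis z_def comm_scalar_prod mult_mat_vec_carrier)
  finally show "r \<bullet> r = y \<bullet> y - z \<bullet> ?w0" .
  fix w :: "real vec"
  assume w: "w \<in> carrier_vec m" "w $ k = 0"
  have d: "?w0 - w \<in> carrier_vec m" "(?w0 - w) $ k = 0" using w w0 k by auto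
  have Ad: "A *\<^sub>v (?w0 - w) \<in> carrier_vec n" using A d by simp
  have "y - A *\<^sub>v w = r + A *\<^sub>v (?w0 - w)"
    using A y w w0 unfolding r_def
    by (subst mult_minus_distrib_mat_vec[of A n m]) (auto intro!: eq_vecI)
  then have "(y - A *\<^sub>v w) \<bullet> (y - A *\<^sub>v w) = r \<bullet> r + (A *\<^sub>v (?w0 - w)) \<bullet> (A *\<^sub>v (?w0 - w))"
    using scalar_prod_self_add[OF r Ad] orth[OF d] by simp
  then show "r \<bullet> r \<le> (y - A *\<^sub>v w) \<bullet> (y - A *\<^sub>v w)"
    using scalar_prod_self_nonneg by simp
qed

section \<open>The Gram matrix of a full column rank matrix\<close>

text \<open>
  A repeated column would make the rank smaller than the number of columns, so the columns are
  distinct and, being as many as the rank, linearly independent.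
\<close>

lemma full_column_rank_inj:
  fixes A :: "'a :: field mat"
  assumes A: "A \<in> carrier_mat n m" and rk: "vec_space.rank n A = m"
    and v: "v \<in> carrier_vec m" and Av: "A *\<^sub>v v = 0\<^sub>v n"
  shows "v = 0\<^sub>v m"
proof (rule ccontr)
  interpret vec_space "TYPE('a)" n .
  assume "v \<noteq> 0\<^sub>v m"
  have "distinct (cols A)"
  proof (rule ccontr)
    assume "\<not> distinct (cols A)"
    then have lt: "card (set (cols A)) < m"
      using A card_distinct card_length[of "cols A"] by (metis carrier_matD(2) cols_length nat_less_le)
    obtain T where T: "maximal T (\<lambda>T. T \<subseteq> set (cols A) \<and> lin_indpt T)"
      using maximal_exists[of "(\<lambda>T. T \<subseteq> set (cols A) \<and> lin_indpt T)" "card (set (cols A))" "{}"]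
      by (meson List.finite_set card_mono empty_iff empty_subsetI finite_lin_indpt2 rev_finite_subset)
    then have "card T \<le> card (set (cols A))" by (simp add: card_mono maximal_def)
    with lt rank_card_indpt[OF A T] rk show False by simp
  qed
  with full_rank_lin_indpt[OF A rk] lin_depI[OF A v \<open>v \<noteq> 0\<^sub>v m\<close> Av] show False by blast
qed

text \<open>
  A vector \<open>v\<close> in the kernel of \<open>A\<^sup>T A\<close> satisfies \<open>(A v) \<bullet> (A v) = (A\<^sup>T A v) \<bullet> v = 0\<close>, so it is
  in the kernel of \<open>A\<close>.
\<close>

lemma gram_mat_inverse:
  fixes A :: "real mat"
  assumes A: "A \<in> carrier_mat n m"
    and inj: "\<And>v. v \<in> carrier_vec m \<Longrightarrow> A *\<^sub>v v = 0\<^sub>v n \<Longrightarrow> v = 0\<^sub>v m"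
  defines "C \<equiv> the (mat_inverse (transpose_mat A * A))"
  shows "C \<in> carrier_mat m m" and "(transpose_mat A * A) * C = 1\<^sub>m m"
proof -
  let ?G = "transpose_mat A * A"
  have At: "transpose_mat A \<in> carrier_mat m n" using A by simp
  have G: "?G \<in> carrier_mat m m" using A by simp
  have "det ?G \<noteq> 0"
  proof
    assume "det ?G = 0"
    then obtain v where v: "v \<in> carrier_vec m" "v \<noteq> 0\<^sub>v m" "?G *\<^sub>v v = 0\<^sub>v m"
      using det_0_iff_vec_prod_zero_field[OF G] by blast
    have Av: "A *\<^sub>v v \<in> carrier_vec n" using A v by simp
    have "(A *\<^sub>v v) \<bullet> (A *\<^sub>v v) = (?G *\<^sub>v v) \<bullet> v"
      using transpose_vec_mult_scalar[OF A v(1) Av] assoc_mult_mat_vec[OF At A v(1)] by simp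
    also have "\<dots> = 0" using v by simp
    finally have "v = 0\<^sub>v m" using scalar_prod_self_eq_0[OF Av] inj v(1) by blast
    with v show False by simp
  qed
  then have "?G \<in> Units (ring_mat TYPE(real) m ())"
    by (rule det_non_zero_imp_unit[OF G])
  then have "mat_inverse ?G = Some C"
    using mat_inverse(1)[OF G, of "()"] unfolding C_def by (cases "mat_inverse ?G") auto
  from mat_inverse(2)[OF G this]
  show "C \<in> carrier_mat m m" and "(transpose_mat A * A) * C = 1\<^sub>m m" by auto
qed

text \<open>
  The division by \<open>e\<^sup>T C e\<close> is legitimate: with \<open>u = C e\<close> this number is \<open>(A u) \<bullet> (A u)\<close>, which
  vanishes only if \<open>A u = 0\<close>, whereas \<open>A\<^sup>T A u = e\<close>.
\<close>

lemma gram_inverse_diagonal_nonzero: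
  fixes A :: "real mat"
  assumes A: "A \<in> carrier_mat n m" and C: "C \<in> carrier_mat m m"
    and inj: "\<And>v. v \<in> carrier_vec m \<Longrightarrow> A *\<^sub>v v = 0\<^sub>v n \<Longrightarrow> v = 0\<^sub>v m"
    and inv: "(transpose_mat A * A) * C = 1\<^sub>m m" and k: "k < m"
  shows "(C *\<^sub>v unit_vec m k) $ k \<noteq> 0"
proof
  let ?e = "unit_vec m k :: real vec"
  let ?u = "C *\<^sub>v ?e"
  assume 0: "?u $ k = 0"
  have At: "transpose_mat A \<in> carrier_mat m n" using A by simp
  have u: "?u \<in> carrier_vec m" using C by simp
  have Au: "A *\<^sub>v ?u \<in> carrier_vec n" using A u by simp
  have "transpose_mat A *\<^sub>v (A *\<^sub>v ?u) = (transpose_mat A * A) *\<^sub>v ?u"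
    by (rule assoc_mult_mat_vec[symmetric, OF At A u])
  also have "\<dots> = ((transpose_mat A * A) * C) *\<^sub>v ?e"
    using C At A by (intro assoc_mult_mat_vec[symmetric, of _ m m _ m]) auto
  also have "\<dots> = ?e" using inv by simp
  finally have Ge: "transpose_mat A *\<^sub>v (A *\<^sub>v ?u) = ?e" .
  have "(A *\<^sub>v ?u) \<bullet> (A *\<^sub>v ?u) = ?e \<bullet> ?u"
    using transpose_vec_mult_scalar[OF A u Au] Ge by simp
  also have "\<dots> = 0" using u k 0 by simp
  finally have "A *\<^sub>v ?u = 0\<^sub>v n" by (rule scalar_prod_self_eq_0[OF Au])
  moreover have "transpose_mat A *\<^sub>v 0\<^sub>v n = 0\<^sub>v m"
    using A by (intro eq_vecI) auto
  ultimately have "?e = 0\<^sub>v m" using Ge by simp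
  then have "?e $ k = 0" using k by simp
  then show False using k by simp
qed

section \<open>The removal score\<close>

text \<open>
  \<open>M\<close> annihilates \<open>e\<close>, so the inner factor \<open>Q\<close> has no effect; the values of \<open>M\<close> have \<open>k\<close>-th
  entry 0, so neither has the outer one.
\<close>

lemma score_matrix_apply:
  fixes C :: "real mat"
  assumes C: "C \<in> carrier_mat m m" and k: "k < m" and z: "z \<in> carrier_vec m"
    and nz: "(C *\<^sub>v unit_vec m k) $ k \<noteq> 0"
  defines "e \<equiv> unit_vec m k :: real vec"
  defines "E \<equiv> outer_prod_vec e e"
  defines "Q \<equiv> 1\<^sub>m m - E"
  defines "M \<equiv> C - (1 / (e \<bullet> (C *\<^sub>v e))) \<cdot>\<^sub>m (C * E * C)"
  shows "Q *\<^sub>v (M *\<^sub>v (Q *\<^sub>v z)) = zeroed_solution C k z"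
proof -
  have e: "e \<in> carrier_vec m" by (simp add: e_def)
  have E: "E \<in> carrier_mat m m" using outer_prod_vec_carrier[OF e e] by (simp add: E_def)
  have M: "M \<in> carrier_mat m m" using C E by (auto simp: M_def)
  have ek: "e \<bullet> x = x $ k" if "x \<in> carrier_vec m" for x
    using that k by (simp add: e_def)
  have Qx: "Q *\<^sub>v x = x - x $ k \<cdot>\<^sub>v e" if x: "x \<in> carrier_vec m" for x
    using x E e ek[OF x] outer_prod_vec_mult_vec[OF e x]
    by (simp add: Q_def E_def minus_mult_distrib_mat_vec[of _ m m])
  have Mx: "M *\<^sub>v x = zeroed_solution C k x" if x: "x \<in> carrier_vec m" for x
  proof -
    have Cx: "C *\<^sub>v x \<in> carrier_vec m" using C x by simp
    have "(C * E * C) *\<^sub>v x = C *\<^sub>v (E *\<^sub>v (C *\<^sub>v x))"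
      using C E x Cx assoc_mult_mat_vec[of "C * E" m m C m x] assoc_mult_mat_vec[of C m m E m]
      by simp
    also have "E *\<^sub>v (C *\<^sub>v x) = (C *\<^sub>v x) $ k \<cdot>\<^sub>v e"
      using outer_prod_vec_mult_vec[OF e Cx] ek[OF Cx] by (simp add: E_def)
    also have "C *\<^sub>v \<dots> = (C *\<^sub>v x) $ k \<cdot>\<^sub>v (C *\<^sub>v e)" by (rule mult_mat_vec[OF C e])
    finally have 1: "(C * E * C) *\<^sub>v x = (C *\<^sub>v x) $ k \<cdot>\<^sub>v (C *\<^sub>v e)" .
    have "M *\<^sub>v x = C *\<^sub>v x - (1 / (C *\<^sub>v e) $ k) \<cdot>\<^sub>v ((C * E * C) *\<^sub>v x)"
      using C E x ek[of "C *\<^sub>v e"] e unfolding M_def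
      by (subst minus_mult_distrib_mat_vec[of _ m m])
         (auto simp: smult_mat_mult_vec[of _ m m] simp del: assoc_mult_mat assoc_mult_mat_vec)
    then show ?thesis
      using C by (simp only: 1) (simp add: zeroed_solution_def e_def smult_smult_assoc)
  qed
  have "M *\<^sub>v e = 0\<^sub>v m"
    using Mx[OF e] nz C by (simp add: zeroed_solution_def e_def)
  moreover have "M *\<^sub>v (Q *\<^sub>v z) = M *\<^sub>v z - z $ k \<cdot>\<^sub>v (M *\<^sub>v e)"
    using z M e by (simp add: Qx mult_minus_distrib_mat_vec[of M m m] mult_mat_vec)
  ultimately have "M *\<^sub>v (Q *\<^sub>v z) = zeroed_solution C k z"
    using Mx[OF z] zeroed_solution_carrier[OF C, of k z] by (auto intro!: eq_vecI)
  moreover have "Q *\<^sub>v zeroed_solution C k z = zeroed_solution C k z"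
    using Qx[OF zeroed_solution_carrier[OF C]] zeroed_solution_index_eq_0[OF C k nz]
      zeroed_solution_carrier[OF C, of k z] e by (auto intro!: eq_vecI)
  ultimately show ?thesis by simp
qed

section \<open>Column submatrices\<close>

lemma bij_betw_pick:
  assumes "finite S"
  shows "bij_betw (pick S) {..<card S} S"
proof (rule bij_betw_byWitness[where f' = "\<lambda>j. card {a \<in> S. a < j}"])
  show "\<forall>k\<in>{..<card S}. card {a \<in> S. a < pick S k} = k"
    by (auto simp: card_pick)
  show "\<forall>j\<in>S. pick S (card {a \<in> S. a < j}) = j"
    by (simp add: pick_card_in_set)
  show "pick S ` {..<card S} \<subseteq> S" by (auto simp: pick_in_set)
  show "(\<lambda>j. card {a \<in> S. a < j}) ` S \<subseteq> {..<card S}"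
    using assms by (auto intro!: psubset_card_mono)
qed

lemma col_submatrix_carrier:
  assumes "X \<in> carrier_mat n p" and "S \<subseteq> {..<p}"
  shows "col_submatrix X S \<in> carrier_mat n (card S)"
proof -
  have "{j. j < p \<and> j \<in> S} = S" using assms(2) by auto
  with assms(1) show ?thesis by (simp add: col_submatrix_def submatrix_def)
qed

lemma col_submatrix_mult_vec:
  assumes X: "X \<in> carrier_mat n p" and S: "S \<subseteq> {..<p}"
    and b: "b \<in> carrier_vec p" and supp: "supp_vec b \<subseteq> S"
  shows "col_submatrix X S *\<^sub>v vec (card S) (\<lambda>k. b $ pick S k) = X *\<^sub>v b"
proof (rule eq_vecI)
  note XS = col_submatrix_carrier[OF X S]
  show "dim_vec (col_submatrix X S *\<^sub>v vec (card S) (\<lambda>k. b $ pick S k)) = dim_vec (X *\<^sub>v b)"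
    using X XS by simp
  fix i assume "i < dim_vec (X *\<^sub>v b)"
  then have i: "i < n" using X by simp
  have fin: "finite S" using S finite_subset by blast
  have idx: "col_submatrix X S $$ (i, k) = X $$ (i, pick S k)" if "k < card S" for k
  proof -
    have "{j. j < p \<and> j \<in> S} = S" using S by auto
    with X i that show ?thesis
      by (simp add: col_submatrix_def submatrix_index pick_UNIV)
  qed
  have "(col_submatrix X S *\<^sub>v vec (card S) (\<lambda>k. b $ pick S k)) $ i =
      (\<Sum>k<card S. X $$ (i, pick S k) * b $ pick S k)"
    using XS i idx by (simp add: scalar_prod_def atLeast0LessThan)
  also have "\<dots> = (\<Sum>j\<in>S. X $$ (i, j) * b $ j)"
    by (rule sum.reindex_bij_betw[OF bij_betw_pick[OF fin]])
  also have "\<dots> = (\<Sum>j<p. X $$ (i, j) * b $ j)"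
    using S supp b by (intro sum.mono_neutral_left) (auto simp: supp_vec_def)
  also have "\<dots> = (X *\<^sub>v b) $ i"
    using X b i by (simp add: scalar_prod_def atLeast0LessThan)
  finally show "(col_submatrix X S *\<^sub>v vec (card S) (\<lambda>k. b $ pick S k)) $ i = (X *\<^sub>v b) $ i" .
qed

section \<open>The restricted loss\<close>

lemma restricted_loss_eq_Inf:
  "restricted_loss X y T =
    Inf {(y - X *\<^sub>v b) \<bullet> (y - X *\<^sub>v b) | b. b \<in> carrier_vec (dim_col X) \<and> supp_vec b = T}"
  by (simp add: restricted_loss_def l2_norm_vec_square)

text \<open>
  Moving \<open>b\<close> along the indicator vector \<open>d\<close> of the missing positions \<open>T - supp_vec b\<close> leaves the
  other entries alone, so \<open>b + t \<cdot>\<^sub>v d\<close> has support exactly \<open>T\<close> for every \<open>t \<noteq> 0\<close>. Its loss is a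
  quadratic polynomial in \<open>t\<close> that tends to the loss of \<open>b\<close> as \<open>t\<close> tends to 0.
\<close>

lemma restricted_loss_le_of_supp_subset:
  assumes X: "X \<in> carrier_mat n p" and y: "y \<in> carrier_vec n" and T: "T \<subseteq> {..<p}"
    and b: "b \<in> carrier_vec p" and supp: "supp_vec b \<subseteq> T"
  shows "restricted_loss X y T \<le> (y - X *\<^sub>v b) \<bullet> (y - X *\<^sub>v b)"
proof -
  define d where "d = vec p (\<lambda>i. if i \<in> T \<and> b $ i = 0 then 1 else 0 :: real)"
  have d: "d \<in> carrier_vec p" by (simp add: d_def)
  define r where "r = y - X *\<^sub>v b"
  have r: "r \<in> carrier_vec n" using X y b by (simp add: r_def)
  let ?v = "X *\<^sub>v d"
  have v: "?v \<in> carrier_vec n" using X d by simp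
  let ?loss = "\<lambda>t. r \<bullet> r + 2 * (- t * (r \<bullet> ?v)) + t * t * (?v \<bullet> ?v)"
  have bound: "restricted_loss X y T \<le> ?loss t" if t: "t \<noteq> 0" for t
  proof -
    let ?b = "b + t \<cdot>\<^sub>v d"
    have bc: "?b \<in> carrier_vec p" using b d by simp
    have "supp_vec ?b = T"
      using b supp T t by (fastforce simp: supp_vec_def d_def)
    moreover have "y - X *\<^sub>v ?b = r + (- t) \<cdot>\<^sub>v ?v"
    proof -
      have "X *\<^sub>v ?b = X *\<^sub>v b + t \<cdot>\<^sub>v ?v"
        using X b d by (simp add: mult_add_distrib_mat_vec[of X n p] mult_mat_vec)
      then show ?thesis using X y v by (auto intro!: eq_vecI simp: r_def)
    qed
    moreover have "(r + (- t) \<cdot>\<^sub>v ?v) \<bullet> (r + (- t) \<cdot>\<^sub>v ?v) = ?loss t"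
      using r v by (simp add: scalar_prod_self_add[of _ n])
    moreover have "restricted_loss X y T \<le> (y - X *\<^sub>v ?b) \<bullet> (y - X *\<^sub>v ?b)"
      unfolding restricted_loss_eq_Inf
      using X bc \<open>supp_vec ?b = T\<close>
      by (intro cInf_lower) (auto intro!: bdd_belowI[of _ 0] scalar_prod_self_nonneg)
    ultimately show ?thesis by simp
  qed
  have "(?loss \<longlongrightarrow> r \<bullet> r + 2 * (- 0 * (r \<bullet> ?v)) + 0 * 0 * (?v \<bullet> ?v)) (at 0)"
    by (intro tendsto_intros)
  then have "(?loss \<longlongrightarrow> r \<bullet> r) (at 0)" by simp
  moreover have "\<forall>\<^sub>F t in at 0. restricted_loss X y T \<le> ?loss t"
    using bound by (auto simp: eventually_at_filter)
  ultimately have "restricted_loss X y T \<le> r \<bullet> r"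
    by (intro tendsto_lowerbound[of ?loss _ "at 0"]) auto
  then show ?thesis by (simp add: r_def)
qed

text \<open>
  The real infimum of the empty set carries no information, so the set of losses has to be seen to
  be nonempty; the indicator vector of \<open>T\<close> provides a member.
\<close>

lemma restricted_loss_ge:
  assumes X: "X \<in> carrier_mat n p" and T: "T \<subseteq> {..<p}"
    and lower: "\<And>b. b \<in> carrier_vec p \<Longrightarrow> supp_vec b = T \<Longrightarrow> c \<le> (y - X *\<^sub>v b) \<bullet> (y - X *\<^sub>v b)"
  shows "c \<le> restricted_loss X y T"
proof -
  let ?b = "vec p (\<lambda>i. if i \<in> T then 1 else 0 :: real)"
  have "supp_vec ?b = T" using T by (auto simp: supp_vec_def split: if_splits)
  then show ?thesis
    unfolding restricted_loss_eq_Inf using X lower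
    by (intro cInf_greatest) (auto intro!: exI[of _ ?b])
qed

text \<open>
  Vectors supported in \<open>S - {j}\<close> correspond, through the enumeration of \<open>S\<close>, to coefficient vectors
  for \<open>X\<^sub>S\<close> whose entry at the position of \<open>j\<close> is 0. So the constrained minimum over the latter is
  a lower bound for the loss, and spreading out its minimiser shows that the bound is sharp.
\<close>

lemma restricted_loss_remove_eq:
  assumes X: "X \<in> carrier_mat n p" and y: "y \<in> carrier_vec n" and S: "S \<subseteq> {..<p}"
    and rk: "vec_space.rank n (col_submatrix X S) = card S" and j: "j \<in> S"
  shows "restricted_loss X y (S - {j}) = y \<bullet> y - removal_score X y S j"
proof -
  define m where "m = card S"
  define A where "A = col_submatrix X S"
  define C where "C = inv_gram X S"
  define pos where "pos = (\<lambda>i. card {a \<in> S. a < i})"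
  define k where "k = pos j"
  define z where "z = transpose_mat A *\<^sub>v y"
  define w0 where "w0 = zeroed_solution C k z"
  have fin: "finite S" using S finite_subset by blast
  have pos: "pos i < m" if "i \<in> S" for i
    unfolding pos_def m_def using fin that by (auto intro!: psubset_card_mono)
  have k: "k < m" using pos[OF j] by (simp add: k_def)
  have A: "A \<in> carrier_mat n m"
    using col_submatrix_carrier[OF X S] by (simp add: A_def m_def)
  have At: "transpose_mat A \<in> carrier_mat m n" using A by simp
  have inj: "\<And>v. v \<in> carrier_vec m \<Longrightarrow> A *\<^sub>v v = 0\<^sub>v n \<Longrightarrow> v = 0\<^sub>v m"
    using full_column_rank_inj[OF A] rk by (simp add: A_def m_def)
  have C: "C \<in> carrier_mat m m" and inv: "(transpose_mat A * A) * C = 1\<^sub>m m"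
    using gram_mat_inverse[OF A inj] by (simp_all add: C_def inv_gram_def A_def)
  have nz: "(C *\<^sub>v unit_vec m k) $ k \<noteq> 0"
    by (rule gram_inverse_diagonal_nonzero[OF A C inj inv k])
  have z: "z \<in> carrier_vec m" using A y by (simp add: z_def)
  have w0: "w0 \<in> carrier_vec m" "w0 $ k = 0"
    unfolding w0_def using zeroed_solution_carrier[OF C] zeroed_solution_index_eq_0[OF C k nz] by auto

  have score: "removal_score X y S j = z \<bullet> w0"
  proof -
    define e :: "real vec" where "e = unit_vec m k"
    define E where "E = outer_prod_vec e e"
    define Q where "Q = 1\<^sub>m m - E"
    define M where "M = C - (1 / (e \<bullet> (C *\<^sub>v e))) \<cdot>\<^sub>m (C * E * C)"
    have E: "E \<in> carrier_mat m m"
      unfolding E_def e_def by (intro outer_prod_vec_carrier) auto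
    have Q: "Q \<in> carrier_mat m m" and M: "M \<in> carrier_mat m m"
      using C E by (auto simp: Q_def M_def)
    have "(A * Q * M * Q * transpose_mat A) *\<^sub>v y = A *\<^sub>v (Q *\<^sub>v (M *\<^sub>v (Q *\<^sub>v z)))"
    proof -
      have "(A * Q * M * Q * transpose_mat A) *\<^sub>v y = (A * Q * M * Q) *\<^sub>v z"
        unfolding z_def using A At Q M y by (intro assoc_mult_mat_vec) auto
      also have "\<dots> = (A * Q * M) *\<^sub>v (Q *\<^sub>v z)"
        using A Q M z by (intro assoc_mult_mat_vec) auto
      also have "\<dots> = (A * Q) *\<^sub>v (M *\<^sub>v (Q *\<^sub>v z))"
        using A Q M z by (intro assoc_mult_mat_vec) auto
      also have "\<dots> = A *\<^sub>v (Q *\<^sub>v (M *\<^sub>v (Q *\<^sub>v z)))"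
        using A Q M z by (intro assoc_mult_mat_vec) auto
      finally show ?thesis .
    qed
    also have "Q *\<^sub>v (M *\<^sub>v (Q *\<^sub>v z)) = w0"
      using score_matrix_apply[OF C k z nz] by (simp add: w0_def Q_def M_def E_def e_def)
    finally have "(A * Q * M * Q * transpose_mat A) *\<^sub>v y = A *\<^sub>v w0" .
    moreover have "removal_score X y S j = y \<bullet> ((A * Q * M * Q * transpose_mat A) *\<^sub>v y)"
      by (simp only: removal_score_def Let_def basis_vec_def A_def Q_def M_def E_def e_def
          C_def k_def pos_def m_def)
    ultimately show ?thesis
      using transpose_vec_mult_scalar[OF A w0(1) y] by (simp add: z_def)
  qed

  let ?r = "y - A *\<^sub>v w0"
  have attained: "?r \<bullet> ?r = y \<bullet> y - z \<bullet> w0"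
    and minimal: "\<And>w. w \<in> carrier_vec m \<Longrightarrow> w $ k = 0 \<Longrightarrow> ?r \<bullet> ?r \<le> (y - A *\<^sub>v w) \<bullet> (y - A *\<^sub>v w)"
    using zeroed_solution_loss[OF A y C inv k nz] by (simp_all add: w0_def z_def)
  have T: "S - {j} \<subseteq> {..<p}" using S by auto

  have "?r \<bullet> ?r \<le> restricted_loss X y (S - {j})"
  proof (rule restricted_loss_ge[OF X T])
    fix b assume b: "b \<in> carrier_vec p" "supp_vec b = S - {j}"
    let ?w = "vec m (\<lambda>k. b $ pick S k)"
    have "j < p" using S j by auto
    with b have "b $ j = 0" by (auto simp: supp_vec_def)
    then have "?w $ k = 0"
      using k j by (simp add: k_def pos_def pick_card_in_set)
    then have "?r \<bullet> ?r \<le> (y - A *\<^sub>v ?w) \<bullet> (y - A *\<^sub>v ?w)"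
      by (intro minimal) auto
    then show "?r \<bullet> ?r \<le> (y - X *\<^sub>v b) \<bullet> (y - X *\<^sub>v b)"
      using col_submatrix_mult_vec[OF X S b(1)] b(2) by (auto simp: A_def m_def)
  qed
  moreover have "restricted_loss X y (S - {j}) \<le> ?r \<bullet> ?r"
  proof -
    define b where "b = vec p (\<lambda>i. if i \<in> S then w0 $ pos i else 0)"
    have b: "b \<in> carrier_vec p" by (simp add: b_def)
    have supp: "supp_vec b \<subseteq> S - {j}"
      using w0(2) by (auto simp: supp_vec_def b_def k_def split: if_splits)
    have "vec m (\<lambda>k. b $ pick S k) = w0"
    proof (rule eq_vecI)
      fix i assume "i < dim_vec w0"
      then have i: "i < card S" using w0 by (simp add: m_def)
      have "pick S i \<in> S" using i by (simp add: pick_in_set)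
      with S have "b $ pick S i = w0 $ pos (pick S i)" by (auto simp: b_def)
      then show "vec m (\<lambda>k. b $ pick S k) $ i = w0 $ i"
        using i by (simp add: pos_def card_pick m_def)
    qed (use w0 in auto)
    moreover have "supp_vec b \<subseteq> S" using supp by blast
    ultimately have "X *\<^sub>v b = A *\<^sub>v w0"
      using col_submatrix_mult_vec[OF X S b] by (simp add: A_def m_def)
    then show ?thesis
      using restricted_loss_le_of_supp_subset[OF X y T b supp] by simp
  qed
  ultimately show ?thesis using attained score by simp
qed

theorem theorem4p2:
  fixes X :: "real mat" and y :: "real vec" and n p :: nat
    and S :: "nat set" and jstar :: nat
  assumes "X \<in> carrier_mat n p"
    and "y \<in> carrier_vec n"
    and "S \<subseteq> {..<p}"
    and "S \<noteq> {}"
    and "vec_space.rank n (col_submatrix X S) = card S"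
    and "is_arg_max (removal_score X y S) (\<lambda>j. j \<in> S) jstar"
  shows "\<forall>j\<in>S. restricted_loss X y (S - {jstar}) \<le> restricted_loss X y (S - {j})"
proof
  fix j assume "j \<in> S"
  moreover from assms(6) have "jstar \<in> S" and "removal_score X y S j \<le> removal_score X y S jstar"
    using \<open>j \<in> S\<close> by (auto simp: is_arg_max_linorder)
  ultimately show "restricted_loss X y (S - {jstar}) \<le> restricted_loss X y (S - {j})"
    using restricted_loss_remove_eq[OF assms(1,2,3,5)] by simp
qed

end
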